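(* Let $n$ be the maximum number of keys, let the key universe $\mathcal{U}$ satisfy $|\mathcal{U}| = \mathrm{poly}(n)$, and let $v \ge 1$ be the value length in bits. There is an incremental retrieval data structure that supports all of its operations (queries, updates, insertions) using an expected size of at most $$ nv + O(n) + O\!\left( \max\left\{ n \log\!\left( \frac{\log n}{v} \right),\, 0\right\} \right) $$ bits.
   Context: A retrieval data structure stores a set $K \subseteq \mathcal{U}$ of at most $n$ keys, each $k\in K$ associated with a $v$-bit value $f(k)$, and answers $\mathrm{Query}(k)$ with $f(k)$ if $k\in K$ and with an arbitrary output if $k\notin K$ (it need not be able to tell whether $k \in K$). An incremental retrieval data structure supports queries, $\mathrm{Update}(k,f)$ (for $k\in K$, change the stored value of $k$ to $f$), and $\mathrm{Insert}(k,f)$ (for $k\notin K$ with $|K|<n$, add $k$ to $K$ with value $f$); deletions are not supported. The size is the number of bits of memory used; the data structure may be randomized and the size is measured in expectation. Logarithms are base 2. *)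

theory Defs
  imports "HOL-Probability.Probability"
begin

type_synonym bits = "bool list"

text \<open>
  The memory of a data structure is a bit string, and it is all that persists between operations:
  random choices to be reused later (hash seeds, say) have to be kept in it and are charged for.
  Operations may toss fresh coins, hence the distributions. The parameters \<open>n\<close>, \<open>v\<close> and the
  universe are known to the data structure and are not stored. Running times are not modelled.
\<close>

record 'k retrieval_ds =
  ds_init :: "bits pmf"
  ds_insert :: "'k \<Rightarrow> bits \<Rightarrow> bits \<Rightarrow> bits pmf"
  ds_update :: "'k \<Rightarrow> bits \<Rightarrow> bits \<Rightarrow> bits pmf"
  ds_query :: "'k \<Rightarrow> bits \<Rightarrow> bits"

datatype 'k operation = Insert 'k bits | Update 'k bits

text \<open>The abstract state is the partial map \<open>f\<close> with domain \<open>K\<close>.\<close>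

fun legal_op :: "nat \<Rightarrow> nat \<Rightarrow> 'k set \<Rightarrow> ('k \<rightharpoonup> bits) \<Rightarrow> 'k operation \<Rightarrow> bool" where
  "legal_op n v U M (Insert k x) \<longleftrightarrow>
     k \<in> U \<and> k \<notin> dom M \<and> card (dom M) < n \<and> length x = v"
| "legal_op n v U M (Update k x) \<longleftrightarrow> k \<in> dom M \<and> length x = v"

fun apply_op :: "('k \<rightharpoonup> bits) \<Rightarrow> 'k operation \<Rightarrow> ('k \<rightharpoonup> bits)" where
  "apply_op M (Insert k x) = M(k \<mapsto> x)"
| "apply_op M (Update k x) = M(k \<mapsto> x)"

fun legal_from :: "nat \<Rightarrow> nat \<Rightarrow> 'k set \<Rightarrow> ('k \<rightharpoonup> bits) \<Rightarrow> 'k operation list \<Rightarrow> bool" where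
  "legal_from n v U M [] \<longleftrightarrow> True"
| "legal_from n v U M (a # as) \<longleftrightarrow> legal_op n v U M a \<and> legal_from n v U (apply_op M a) as"

definition legal :: "nat \<Rightarrow> nat \<Rightarrow> 'k set \<Rightarrow> 'k operation list \<Rightarrow> bool" where
  "legal n v U as \<longleftrightarrow> legal_from n v U Map.empty as"

definition contents :: "'k operation list \<Rightarrow> ('k \<rightharpoonup> bits)" where
  "contents as = foldl apply_op Map.empty as"

fun exec_op :: "'k retrieval_ds \<Rightarrow> 'k operation \<Rightarrow> bits \<Rightarrow> bits pmf" where
  "exec_op D (Insert k x) s = ds_insert D k x s"
| "exec_op D (Update k x) s = ds_update D k x s"

text \<open>The distribution of the memory after a sequence of operations fixed in advance.\<close>

definition memory_after :: "'k retrieval_ds \<Rightarrow> 'k operation list \<Rightarrow> bits pmf" where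
  "memory_after D as = foldl (\<lambda>p a. bind_pmf p (exec_op D a)) (ds_init D) as"

text \<open>Queries on stored keys never err; nothing is required of \<open>ds_query\<close> on other keys.\<close>

definition incremental_retrieval :: "nat \<Rightarrow> nat \<Rightarrow> 'k set \<Rightarrow> 'k retrieval_ds \<Rightarrow> bool" where
  "incremental_retrieval n v U D \<longleftrightarrow>
     (\<forall>as. legal n v U as \<longrightarrow>
        (\<forall>s \<in> set_pmf (memory_after D as). \<forall>k x.
           contents as k = Some x \<longrightarrow> ds_query D k s = x))"

text \<open>A nonnegative integral, so that an infinite expectation is not collapsed to 0.\<close>

definition expected_size :: "'k retrieval_ds \<Rightarrow> 'k operation list \<Rightarrow> ennreal" where
  "expected_size D as = (\<integral>\<^sup>+ s. of_nat (length s) \<partial>measure_pmf (memory_after D as))"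

definition expected_size_at_most :: "nat \<Rightarrow> nat \<Rightarrow> 'k set \<Rightarrow> 'k retrieval_ds \<Rightarrow> real \<Rightarrow> bool" where
  "expected_size_at_most n v U D B \<longleftrightarrow>
     (\<forall>as. legal n v U as \<longrightarrow> expected_size D as \<le> ennreal B)"

end

theory Submission
  imports Defs
begin

text \<open>
  Hash every key to a long bit string by a random linear map over GF(2); its matrix has
  \<open>O(log\<^sup>2 n)\<close> entries and is kept in memory. Store the values in the leaves of the binary trie of
  the hashes. A leaf does not record whose value it holds: all keys whose hash leads to it get that
  value, except those that are listed explicitly, each at a cost of \<open>O(log n)\<close> bits.

  If \<open>i\<close> keys are present, a branch that belongs to a single key is cut off at depth
  \<open>D i = log n + log (log n / v) + (n - i) v / (3 n)\<close>, where a \<open>v\<close> exceeding the key length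
  \<open>O(log n)\<close> is replaced by the latter. Below the top \<open>log n\<close> levels the trie then
  spends about \<open>3 (D i - log n)\<close> bits per key, and the part that depends on \<open>i\<close> fits into the
  \<open>(n - i) v\<close> bits reserved for values yet to come. A new key has to be listed explicitly only if it
  agrees with an earlier key on the first \<open>D i\<close> hash bits, which has probability at most
  \<open>n / 2 ^ D i\<close>. These probabilities form a geometric series in \<open>i\<close> whose sum is \<open>O(n / log n)\<close>, so that
  all explicit keys together cost \<open>O(n)\<close> bits.
\<close>

section \<open>Tries of hashed keys and the operations on them\<close>

datatype 'k trie = Empty | Leaf bits "('k \<times> bits) list" | Node "'k trie" "'k trie"

text \<open>In a trie that represents a map, only absent keys reach an \<open>Empty\<close> subtree,
  so the answer \<open>[]\<close> there is an arbitrary default.\<close>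

fun lookup :: "('k \<Rightarrow> nat \<Rightarrow> bool) \<Rightarrow> nat \<Rightarrow> 'k trie \<Rightarrow> 'k \<Rightarrow> bits" where
  "lookup h d Empty k = []"
| "lookup h d (Leaf x es) k = (case map_of es k of Some y \<Rightarrow> y | None \<Rightarrow> x)"
| "lookup h d (Node l r) k = lookup h (Suc d) (if h k d then r else l) k"

text \<open>Only stored keys are updated, so a key that reaches a leaf without being listed there
  must be the owner of the leaf.\<close>

fun trie_update :: "('k \<Rightarrow> nat \<Rightarrow> bool) \<Rightarrow> nat \<Rightarrow> 'k \<Rightarrow> bits \<Rightarrow> 'k trie \<Rightarrow> 'k trie" where
  "trie_update h d k y Empty = Empty"
| "trie_update h d k y (Leaf x es) =
     (if k \<in> fst ` set es then Leaf x (map (\<lambda>e. if fst e = k then (k, y) else e) es) else Leaf y es)"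
| "trie_update h d k y (Node l r) =
     (if h k d then Node l (trie_update h (Suc d) k y r) else Node (trie_update h (Suc d) k y l) r)"

fun branch :: "('k \<Rightarrow> nat \<Rightarrow> bool) \<Rightarrow> 'k \<Rightarrow> bits \<Rightarrow> nat \<Rightarrow> nat \<Rightarrow> 'k trie" where
  "branch h k x d 0 = Leaf x []"
| "branch h k x d (Suc j) =
     (if h k d then Node Empty (branch h k x (Suc d) j) else Node (branch h k x (Suc d) j) Empty)"

text \<open>A leaf has no record of its owner, so a key that runs into it cannot be separated from
  the owner and becomes an exception, even if their hashes differ further down. The truncated
  \<open>D - d\<close> yields a bare leaf when the empty subtree lies at depth \<open>D\<close> or
  below.\<close>

fun trie_insert :: "('k \<Rightarrow> nat \<Rightarrow> bool) \<Rightarrow> nat \<Rightarrow> nat \<Rightarrow> 'k \<Rightarrow> bits \<Rightarrow> 'k trie \<Rightarrow> 'k trie" where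
  "trie_insert h D d k y Empty = branch h k y d (D - d)"
| "trie_insert h D d k y (Leaf x es) = Leaf x ((k, y) # es)"
| "trie_insert h D d k y (Node l r) =
     (if h k d then Node l (trie_insert h D (Suc d) k y r) else Node (trie_insert h D (Suc d) k y l) r)"

fun keys :: "'k trie \<Rightarrow> nat" where
  "keys Empty = 0"
| "keys (Leaf x es) = Suc (length es)"
| "keys (Node l r) = keys l + keys r"

fun exceptions :: "'k trie \<Rightarrow> nat" where
  "exceptions Empty = 0"
| "exceptions (Leaf x es) = length es"
| "exceptions (Node l r) = exceptions l + exceptions r"

fun nodes :: "'k trie \<Rightarrow> nat" where
  "nodes Empty = 0"
| "nodes (Leaf x es) = 0"
| "nodes (Node l r) = Suc (nodes l + nodes r)"

text \<open>Meaningful only for a trie with exactly one key.\<close>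

fun sole_value :: "'k trie \<Rightarrow> bits" where
  "sole_value Empty = []"
| "sole_value (Leaf x es) = x"
| "sole_value (Node l r) = (if keys l = 0 then sole_value r else sole_value l)"

text \<open>The cut-off depth falls as keys arrive; shortening the older single-key branches frees
  the space that the values of later keys take up.\<close>

fun prune :: "nat \<Rightarrow> nat \<Rightarrow> 'k trie \<Rightarrow> 'k trie" where
  "prune D d Empty = Empty"
| "prune D d (Leaf x es) = Leaf x es"
| "prune D d (Node l r) =
     (if D \<le> d \<and> keys (Node l r) = 1 then Leaf (sole_value (Node l r)) []
      else Node (prune D (Suc d) l) (prune D (Suc d) r))"

text \<open>
  \<open>m\<close> is the number of hash bits and \<open>D\<close> the current cut-off depth. The existentially quantified key
  is the unrecorded owner of the leaf. From depth \<open>D\<close> on, every inner node has two keys below it and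
  is thus paid for by a collision.
\<close>

fun represents ::
  "('k \<Rightarrow> nat \<Rightarrow> bool) \<Rightarrow> nat \<Rightarrow> nat \<Rightarrow> nat \<Rightarrow> 'k trie \<Rightarrow> ('k \<rightharpoonup> bits) \<Rightarrow> bool" where
  "represents h m D d Empty M \<longleftrightarrow> M = Map.empty"
| "represents h m D d (Leaf x es) M \<longleftrightarrow> D \<le> d \<and> distinct (map fst es) \<and>
     (\<exists>k. k \<notin> fst ` set es \<and> M = (map_of es)(k \<mapsto> x))"
| "represents h m D d (Node l r) M \<longleftrightarrow> d < m \<and> M \<noteq> Map.empty \<and> (D \<le> d \<longrightarrow> 2 \<le> card (dom M)) \<and>
     represents h m D (Suc d) l (M |` {k. \<not> h k d}) \<and>
     represents h m D (Suc d) r (M |` {k. h k d})"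

section \<open>Correctness of the trie operations\<close>

lemma dom_split: "card (dom (M |` {k. \<not> h k d})) + card (dom (M |` {k. h k d})) = card (dom M)"
  if "finite (dom M)" for M :: "'k \<rightharpoonup> bits" and h :: "'k \<Rightarrow> nat \<Rightarrow> bool"
proof -
  have "dom M = dom (M |` {k. \<not> h k d}) \<union> dom (M |` {k. h k d})" by auto
  moreover have "dom (M |` {k. \<not> h k d}) \<inter> dom (M |` {k. h k d}) = {}" by auto
  ultimately show ?thesis using that by (metis card_Un_disjoint finite_Un)
qed

lemma represents_finite: "represents h m D d T M \<Longrightarrow> finite (dom M)"
proof (induction T arbitrary: d M)
  case (Node l r)
  have "dom M = dom (M |` {k. \<not> h k d}) \<union> dom (M |` {k. h k d})" by auto
  with Node show ?case by (metis finite_UnI represents.simps(3))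
qed (auto simp: finite_dom_map_of)

text \<open>The memory holds no counter: the number of keys, and with it the current cut-off depth,
  is read off the trie.\<close>

lemma represents_keys: "represents h m D d T M \<Longrightarrow> keys T = card (dom M)"
proof (induction T arbitrary: d M)
  case (Leaf x es)
  then obtain k where k: "k \<notin> fst ` set es" "M = (map_of es)(k \<mapsto> x)" "distinct (map fst es)" by auto
  have "dom M = insert k (fst ` set es)" using k by (auto simp: dom_map_of_conv_image_fst)
  moreover have "card (fst ` set es) = length es" 
    using k(3) by (metis distinct_card length_map set_map)
  ultimately have "card (dom M) = Suc (length es)" using k(1) by simp
  then show ?case by simp
next
  case (Node l r)
  then have "keys l = card (dom (M |` {k. \<not> h k d}))" "keys r = card (dom (M |` {k. h k d}))"
    unfolding represents.simps by blast+
  then show ?case using dom_split[OF represents_finite[OF Node.prems], of h d] by simp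
qed auto

lemma represents_lookup: "represents h m D d T M \<Longrightarrow> M k = Some x \<Longrightarrow> lookup h d T k = x"
proof (induction T arbitrary: d M)
  case (Leaf y es)
  then show ?case by (auto split: option.splits if_splits simp: map_of_eq_None_iff rev_image_eqI)
next
  case (Node l r)
  show ?case
  proof (cases "h k d")
    case True
    then show ?thesis using Node.IH(2)[of "Suc d" "M |` {k. h k d}"] Node.prems by simp
  next
    case False
    then show ?thesis using Node.IH(1)[of "Suc d" "M |` {k. \<not> h k d}"] Node.prems by simp
  qed
qed auto

text \<open>Setting the value of \<open>k\<close> changes only one of the two restrictions of
  \<open>M\<close> and cannot make the domain smaller. This is the inductive step shared by updates
  and insertions.\<close>

lemma represents_Node_upd:
  assumes "represents h m D d (Node l r) M"
    and "h k d \<Longrightarrow> represents h m D (Suc d) r' ((M |` {k. h k d})(k \<mapsto> y))"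
    and "\<not> h k d \<Longrightarrow> represents h m D (Suc d) l' ((M |` {k. \<not> h k d})(k \<mapsto> y))"
  shows "represents h m D d (if h k d then Node l r' else Node l' r) (M(k \<mapsto> y))"
proof -
  have "card (dom M) \<le> card (dom (M(k \<mapsto> y)))"
    using represents_finite[OF assms(1)] by (intro card_mono) auto
  then have c: "d < m" "D \<le> d \<longrightarrow> 2 \<le> card (dom (M(k \<mapsto> y)))" "M(k \<mapsto> y) \<noteq> Map.empty"
    using assms(1) by (auto simp only: represents.simps map_upd_nonempty)
  show ?thesis
  proof (cases "h k d")
    case True
    then have "(M(k \<mapsto> y)) |` {k. h k d} = (M |` {k. h k d})(k \<mapsto> y)"
      "(M(k \<mapsto> y)) |` {k. \<not> h k d} = M |` {k. \<not> h k d}"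
      by (auto simp: restrict_map_def fun_eq_iff)
    then show ?thesis using True c assms(1,2) by (simp only: represents.simps if_True) simp
  next
    case False
    then have "(M(k \<mapsto> y)) |` {k. \<not> h k d} = (M |` {k. \<not> h k d})(k \<mapsto> y)"
      "(M(k \<mapsto> y)) |` {k. h k d} = M |` {k. h k d}"
      by (auto simp: restrict_map_def fun_eq_iff)
    then show ?thesis using False c assms(1,3) by (simp only: represents.simps if_False) simp
  qed
qed

lemma map_of_map_update:
  "k \<in> fst ` set es \<Longrightarrow> map_of (map (\<lambda>e. if fst e = k then (k, y) else e) es) = (map_of es)(k \<mapsto> y)"
proof (induction es)
  case (Cons e es)
  show ?case
  proof (cases "k \<in> fst ` set es")
    case True
    then show ?thesis using Cons by (cases e) (auto simp: fun_eq_iff)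
  next
    case False
    then have "map (\<lambda>e. if fst e = k then (k, y) else e) es = es"
      by (intro map_idI) (auto simp: image_iff)
    then show ?thesis using Cons.prems False by (cases e) (auto simp: fun_eq_iff)
  qed
qed auto

lemma map_fst_update: "map fst (map (\<lambda>e. if fst e = k then (k, y) else e) es) = map fst es"
  by (induction es) auto

lemma represents_LeafI:
  "D \<le> d \<Longrightarrow> distinct (map fst es) \<Longrightarrow> k \<notin> fst ` set es \<Longrightarrow> M = (map_of es)(k \<mapsto> x) \<Longrightarrow>
    represents h m D d (Leaf x es) M"
  unfolding represents.simps by blast

lemma represents_update:
  "represents h m D d T M \<Longrightarrow> k \<in> dom M \<Longrightarrow> represents h m D d (trie_update h d k y T) (M(k \<mapsto> y))"
proof (induction T arbitrary: d M)
  case (Leaf x es)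
  then obtain k0 where k0: "k0 \<notin> fst ` set es" "M = (map_of es)(k0 \<mapsto> x)" "distinct (map fst es)" "D \<le> d"
    by auto
  show ?case
  proof (cases "k \<in> fst ` set es")
    case True
    then have "k \<noteq> k0" using k0 by auto
    let ?es = "map (\<lambda>e. if fst e = k then (k, y) else e) es"
    have "k0 \<notin> fst ` set ?es" using k0(1) map_fst_update[of k y es] by (metis set_map)
    moreover have "M(k \<mapsto> y) = (map_of ?es)(k0 \<mapsto> x)"
      unfolding map_of_map_update[OF True] using k0 \<open>k \<noteq> k0\<close> by (simp add: fun_upd_twist)
    moreover have "distinct (map fst ?es)" unfolding map_fst_update by (rule k0(3))
    ultimately have "represents h m D d (Leaf x ?es) (M(k \<mapsto> y))"
      using k0(4) by (intro represents_LeafI[where k = k0])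
    then show ?thesis using True by (simp only: trie_update.simps if_True)
  next
    case False
    have "dom M = insert k0 (fst ` set es)" using k0(2) by (auto simp: dom_map_of_conv_image_fst)
    \<comment> \<open>A stored key that is not listed can only be the owner.\<close>
    then have "k = k0" using Leaf.prems(2) False by auto
    then have "represents h m D d (Leaf y es) (M(k \<mapsto> y))"
      using k0 by (intro represents_LeafI[where k = k0]) simp_all
    then show ?thesis using False by (simp only: trie_update.simps if_False)
  qed
next
  case (Node l r)
  show ?case unfolding trie_update.simps
    using Node.prems by (intro represents_Node_upd Node.IH) auto
qed auto

text \<open>All inner nodes of the path lie above depth \<open>D\<close>, where a node may have a
  single key below it; \<open>D \<le> m\<close> guarantees a hash bit for each of them.\<close>

lemma represents_branch:
  "D \<le> m \<Longrightarrow> j = D - d \<Longrightarrow> represents h m D d (branch h k x d j) [k \<mapsto> x]"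
proof (induction j arbitrary: d)
  case (Suc j)
  have r: "[k \<mapsto> x] |` {k'. h k' d} = (if h k d then [k \<mapsto> x] else Map.empty)"
    "[k \<mapsto> x] |` {k'. \<not> h k' d} = (if h k d then Map.empty else [k \<mapsto> x])"
    by (auto simp: restrict_map_def fun_eq_iff)
  have "represents h m D (Suc d) (branch h k x (Suc d) j) [k \<mapsto> x]"
    using Suc.prems by (intro Suc.IH) auto
  moreover have "d < m" "\<not> D \<le> d" using Suc.prems by auto
  ultimately show ?case
    by (simp only: branch.simps represents.simps r split: if_split) simp
qed auto

lemma represents_insert:
  "represents h m D d T M \<Longrightarrow> k \<notin> dom M \<Longrightarrow> D \<le> m \<Longrightarrow>
    represents h m D d (trie_insert h D d k y T) (M(k \<mapsto> y))"
proof (induction T arbitrary: d M)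
  case Empty
  then have "M = Map.empty" by simp
  then show ?case using represents_branch[of D m "D - d" d h k y] Empty by (simp only: trie_insert.simps)
next
  case (Leaf x es)
  then obtain k0 where k0: "k0 \<notin> fst ` set es" "M = (map_of es)(k0 \<mapsto> x)" "distinct (map fst es)" "D \<le> d"
    by auto
  have "dom M = insert k0 (fst ` set es)" using k0(2) by (auto simp: dom_map_of_conv_image_fst)
  then have k: "k \<noteq> k0" "k \<notin> fst ` set es" using Leaf.prems by auto
  \<comment> \<open>The owner \<open>k0\<close> stays the owner; the new key joins the
    exceptions.\<close>
  have "M(k \<mapsto> y) = (map_of ((k, y) # es))(k0 \<mapsto> x)" using k0(2) k by (simp add: fun_upd_twist)
  moreover have "k0 \<notin> fst ` set ((k, y) # es)" "distinct (map fst ((k, y) # es))" using k k0 by auto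
  ultimately show ?case unfolding trie_insert.simps represents.simps using k0(4) by blast
next
  case (Node l r)
  show ?case unfolding trie_insert.simps
    using Node.prems by (intro represents_Node_upd Node.IH) auto
qed

lemma represents_sole_value:
  "represents h m D d T M \<Longrightarrow> keys T = 1 \<Longrightarrow> \<exists>k. M = [k \<mapsto> sole_value T]"
proof (induction T arbitrary: d M)
  case (Node l r)
  have fin: "finite (dom M)" using Node.prems represents_finite by blast
  let ?M0 = "M |` {k. \<not> h k d}" and ?M1 = "M |` {k. h k d}"
  have rep: "represents h m D (Suc d) l ?M0" "represents h m D (Suc d) r ?M1" using Node.prems by auto
  have M: "M = ?M0 ++ ?M1" by (auto simp: fun_eq_iff restrict_map_def map_add_def split: option.splits)
  show ?case
  proof (cases "keys l = 0")
    case True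
    then have "card (dom ?M0) = 0" using represents_keys[OF rep(1)] by simp
    then have "?M0 = Map.empty" using represents_finite[OF rep(1)] by (metis card_0_eq dom_eq_empty_conv)
    moreover obtain k where "?M1 = [k \<mapsto> sole_value r]"
      using Node.IH(2)[OF rep(2)] Node.prems(2) True by (metis add_0 keys.simps(3))
    ultimately have "M = Map.empty ++ [k \<mapsto> sole_value r]" using M by argo
    then have "M = [k \<mapsto> sole_value (Node l r)]"
      by (simp only: empty_map_add sole_value.simps True if_True refl)
    then show ?thesis by (rule exI)
  next
    case False
    then have "keys r = 0" using Node.prems by auto
    then have "card (dom ?M1) = 0" using represents_keys[OF rep(2)] by simp
    then have "?M1 = Map.empty" using represents_finite[OF rep(2)] by (metis card_0_eq dom_eq_empty_conv)
    moreover obtain k where "?M0 = [k \<mapsto> sole_value l]"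
      using Node.IH(1)[OF rep(1)] Node.prems(2) \<open>keys r = 0\<close> by (metis add_0_right keys.simps(3))
    ultimately have "M = [k \<mapsto> sole_value l] ++ Map.empty" using M by argo
    then have "M = [k \<mapsto> sole_value (Node l r)]"
      by (simp only: map_add_empty sole_value.simps False if_False)
    then show ?thesis by (rule exI)
  qed
next
  case (Leaf x es)
  then have "es = []" by simp
  moreover obtain k where "M = (map_of es)(k \<mapsto> x)" using Leaf.prems(1) unfolding represents.simps by blast
  ultimately have "M = [k \<mapsto> sole_value (Leaf x es)]" by (simp only: map_of.simps sole_value.simps)
  then show ?case by (rule exI)
qed simp

text \<open>Lowering the cut-off depth only weakens the condition on leaves. Inner nodes that are
  now too deep for a single key are exactly those that get collapsed.\<close>

lemma represents_prune:
  "represents h m D' d T M \<Longrightarrow> D \<le> D' \<Longrightarrow> represents h m D d (prune D d T) M"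
proof (induction T arbitrary: d M)
  case (Node l r)
  have k: "keys (Node l r) = card (dom M)" using represents_keys[OF Node.prems(1)] .
  show ?case
  proof (cases "D \<le> d \<and> keys (Node l r) = 1")
    case True
    then obtain k where "M = [k \<mapsto> sole_value (Node l r)]"
      using represents_sole_value[OF Node.prems(1)] by blast
    then have "represents h m D d (Leaf (sole_value (Node l r)) []) M"
      unfolding represents.simps using True by auto
    then show ?thesis using True by simp
  next
    case False
    have "finite (dom M)" using Node.prems represents_finite by blast
    then have "card (dom M) \<noteq> 0" using Node.prems by auto
    then have "D \<le> d \<longrightarrow> 2 \<le> card (dom M)" using False k by auto
    moreover have "represents h m D (Suc d) (prune D (Suc d) l) (M |` {k. \<not> h k d})"
      "represents h m D (Suc d) (prune D (Suc d) r) (M |` {k. h k d})"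
      using Node.prems by (auto intro!: Node.IH)
    moreover have "prune D d (Node l r) = Node (prune D (Suc d) l) (prune D (Suc d) r)"
      using False by (simp only: prune.simps if_False)
    ultimately show ?thesis using Node.prems by simp
  qed
next
  case (Leaf x es)
  from Leaf.prems(1) have "D' \<le> d" unfolding represents.simps by (rule conjunct1)
  with Leaf.prems(2) have "D \<le> d" by simp
  with Leaf.prems(1) show ?case unfolding represents.simps prune.simps by iprover
qed simp

lemma exceptions_prune: "exceptions (prune D d T) \<le> exceptions T"
proof (induction T arbitrary: d)
  case (Node l r)
  then show ?case using add_mono[OF Node.IH(1)[of "Suc d"] Node.IH(2)[of "Suc d"]] by simp
qed auto

section \<open>Inner nodes and exceptions charged to hash collisions\<close>

text \<open>One triple for every ordered pair of keys and every level \<open>j\<close>, from the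
  cut-off depth on, at which the pair is still together. An inner node at depth
  \<open>j \<ge> D\<close> has two keys below it and can be charged to such a triple.\<close>

definition collisions ::
  "('k \<Rightarrow> nat \<Rightarrow> bool) \<Rightarrow> nat \<Rightarrow> nat \<Rightarrow> nat \<Rightarrow> 'k set \<Rightarrow> ('k \<times> 'k \<times> nat) set" where
  "collisions h m D d K = {(k, k', j). k \<in> K \<and> k' \<in> K \<and> k \<noteq> k' \<and> max d D \<le> j \<and> j < m \<and>
     (\<forall>i\<in>{d..<j}. h k i = h k' i)}"

lemma finite_collisions: "finite K \<Longrightarrow> finite (collisions h m D d K)"
  by (rule finite_subset[of _ "K \<times> K \<times> {..<m}"]) (auto simp: collisions_def)

text \<open>The collisions within either half have \<open>j > d\<close> and remain collisions of the
  whole, since the keys of a half agree on bit \<open>d\<close>. Those with \<open>j = d\<close> are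
  new: the agreement condition is then vacuous, so any two distinct keys provide one.\<close>

lemma card_collisions_split:
  assumes "finite K"
  shows "card (collisions h m D (Suc d) {k\<in>K. \<not> h k d}) + card (collisions h m D (Suc d) {k\<in>K. h k d}) +
    of_bool (D \<le> d \<and> d < m \<and> 2 \<le> card K) \<le> card (collisions h m D d K)"
    (is "card ?A + card ?B + _ \<le> _")
proof -
  define C where "C = {(k, k', j). k \<in> K \<and> k' \<in> K \<and> k \<noteq> k' \<and> j = d \<and> D \<le> d \<and> d < m}"
  have fin: "finite ?A" "finite ?B" using assms by (auto intro: finite_collisions)
  have finC: "finite C" by (rule finite_subset[of _ "K \<times> K \<times> {d}"]) (use assms in \<open>auto simp: C_def\<close>)
  have C: "of_bool (D \<le> d \<and> d < m \<and> 2 \<le> card K) \<le> card C"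
  proof (cases "D \<le> d \<and> d < m \<and> 2 \<le> card K")
    case True
    then obtain k k' where "k \<in> K" "k' \<in> K" "k \<noteq> k'"
      by (metis card_le_Suc0_iff_eq assms not_less_eq_eq numeral_2_eq_2)
    then have "(k, k', d) \<in> C" using True by (simp add: C_def)
    then have "card C \<noteq> 0" using finC by auto
    then show ?thesis by simp
  qed auto
  have disj: "?A \<inter> ?B = {}" "(?A \<union> ?B) \<inter> C = {}" by (auto simp: collisions_def C_def)
  have ext: "\<forall>i\<in>{d..<j}. h k i = h k' i"
    if "\<forall>i\<in>{Suc d..<j}. h k i = h k' i" "h k d = h k' d" for k k' j
    using that by (metis atLeastLessThan_iff le_antisym not_less_eq_eq)
  have "collisions h m D (Suc d) {k\<in>K. h k d = b} \<subseteq> collisions h m D d K" for b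
  proof (rule subrelI)
    fix k p assume "(k, p) \<in> collisions h m D (Suc d) {k\<in>K. h k d = b}"
    then obtain k' j where p: "p = (k', j)" and k: "k \<in> K" "k' \<in> K" "k \<noteq> k'" "h k d = h k' d" "j < m"
      "max (Suc d) D \<le> j" "\<forall>i\<in>{Suc d..<j}. h k i = h k' i"
      unfolding collisions_def by blast
    show "(k, p) \<in> collisions h m D d K"
      using k ext[OF k(7,4)] unfolding collisions_def p by simp
  qed
  from this[of False] this[of True] have "?A \<subseteq> collisions h m D d K" "?B \<subseteq> collisions h m D d K" by simp_all
  moreover have "C \<subseteq> collisions h m D d K" unfolding collisions_def C_def by auto
  ultimately have "?A \<union> ?B \<union> C \<subseteq> collisions h m D d K" by blast
  then have "card (?A \<union> ?B \<union> C) \<le> card (collisions h m D d K)"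
    by (intro card_mono finite_collisions assms)
  moreover have "card (?A \<union> ?B \<union> C) = card ?A + card ?B + card C"
    using fin finC disj by (simp add: card_Un_disjoint)
  ultimately show ?thesis using C by linarith
qed

text \<open>Three zones: above depth \<open>l\<close> the trie is at most a complete binary tree;
  between \<open>l\<close> and \<open>D\<close> each key accounts for at most one node per level;
  from \<open>D\<close> on each node is charged to a collision.\<close>

lemma nodes_le:
  "represents h m D d T M \<Longrightarrow> l \<le> D \<Longrightarrow>
    nodes T \<le> (2 ^ (l - d) - 1) + card (dom M) * (D - max d l) + card (collisions h m D d (dom M))"
proof (induction T arbitrary: d M)
  case (Node t u)
  let ?M0 = "M |` {k. \<not> h k d}" and ?M1 = "M |` {k. h k d}"
  have fin: "finite (dom M)" using Node.prems represents_finite by blast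
  have rep: "represents h m D (Suc d) t ?M0" "represents h m D (Suc d) u ?M1"
    and d: "d < m" "D \<le> d \<longrightarrow> 2 \<le> card (dom M)" and M: "M \<noteq> Map.empty"
    using Node.prems(1) unfolding represents.simps by blast+
  have pos: "1 \<le> card (dom M)" using fin M by (simp add: Suc_leI card_gt_0_iff)
  have dom: "dom ?M0 = {k\<in>dom M. \<not> h k d}" "dom ?M1 = {k\<in>dom M. h k d}" by auto
  define c0 c1 A0 A1 A where defs: "c0 = card (dom ?M0)" "c1 = card (dom ?M1)"
    "A0 = card (collisions h m D (Suc d) (dom ?M0))" "A1 = card (collisions h m D (Suc d) (dom ?M1))"
    "A = card (collisions h m D d (dom M))"
  have c: "card (dom M) = c0 + c1" using dom_split[OF fin, of h d] defs by simp
  have A: "A0 + A1 + of_bool (D \<le> d) \<le> A"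
    using card_collisions_split[OF fin, of h m D d] d unfolding defs dom by auto
  have IH: "nodes t \<le> (2 ^ (l - Suc d) - 1) + c0 * (D - max (Suc d) l) + A0"
    "nodes u \<le> (2 ^ (l - Suc d) - 1) + c1 * (D - max (Suc d) l) + A1"
    using Node.IH(1)[OF rep(1) Node.prems(2)] Node.IH(2)[OF rep(2) Node.prems(2)] unfolding defs by auto
  have "Suc (nodes t + nodes u) \<le> (2 ^ (l - d) - 1) + (c0 + c1) * (D - max d l) + A"
  proof (cases "d < l")
    case True
    then have "l - d = Suc (l - Suc d)" by (simp only: Suc_diff_Suc)
    then have "(2::nat) ^ (l - d) = 2 * 2 ^ (l - Suc d)" by (simp only: power_Suc)
    moreover have "1 \<le> (2::nat) ^ (l - Suc d)" by simp
    \<comment> \<open>A complete binary tree is a root and two complete trees of one level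
      less.\<close>
    ultimately have "(2::nat) ^ (l - d) - 1 = 1 + 2 * (2 ^ (l - Suc d) - 1)" by linarith
    moreover have "max (Suc d) l = max d l" using True by simp
    ultimately show ?thesis using IH A unfolding add_mult_distrib by linarith
  next
    case False
    show ?thesis
    proof (cases "d < D")
      case True
      \<comment> \<open>The node is paid for by one level of one of its keys, of which there is at
        least one by \<open>pos\<close>.\<close>
      define e where "e = D - Suc d"
      have e: "D - max d l = Suc e" "D - max (Suc d) l = e" using True False unfolding e_def by auto
      have "l - d = 0" "l - Suc d = 0" using False by auto
      then show ?thesis using IH A pos c unfolding e add_mult_distrib mult_Suc_right by simp
    next
      case False
      \<comment> \<open>Here the summand \<open>of_bool (D \<le> d)\<close> in \<open>A\<close> is 1
        and pays for the node.\<close>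
      then show ?thesis using IH A \<open>\<not> d < l\<close> by simp
    qed
  qed
  then show ?case using c defs by simp
qed auto

lemma exceptions_branch: "exceptions (branch h k x d j) = 0"
  by (induction j arbitrary: d) auto

text \<open>An exception arises only at a leaf, whose depth is at least \<open>D\<close>; the keys
  there agree with \<open>k\<close> on all bits before \<open>D\<close>.\<close>

lemma exceptions_insert:
  "represents h m D d T M \<Longrightarrow>
    exceptions (trie_insert h D d k y T) \<le> exceptions T + card {k'\<in>dom M. \<forall>i\<in>{d..<D}. h k' i = h k i}"
proof (induction T arbitrary: d M)
  case Empty
  then show ?case by (simp add: exceptions_branch)
next
  case (Leaf x es)
  have "finite (dom M)" using Leaf represents_finite by blast
  moreover have "D \<le> d" "card (dom M) = Suc (length es)" using Leaf represents_keys[OF Leaf] by auto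
  \<comment> \<open>As \<open>D \<le> d\<close>, the agreement condition is vacuous and all keys of
    the leaf are counted, which is at least one.\<close>
  ultimately show ?case by (simp add: Collect_conj_eq dom_def)
next
  case (Node l r)
  have fin: "finite (dom M)" using Node.prems represents_finite by blast
  let ?M0 = "M |` {k. \<not> h k d}" and ?M1 = "M |` {k. h k d}"
  have rep: "represents h m D (Suc d) l ?M0" "represents h m D (Suc d) r ?M1"
    using Node.prems(1) unfolding represents.simps by blast+
  have step: "\<forall>i\<in>{d..<D}. h k' i = h k i"
    if "\<forall>i\<in>{Suc d..<D}. h k' i = h k i" "h k' d = h k d" for k'
    using that by (metis atLeastLessThan_iff le_antisym not_less_eq_eq)
  show ?case
  proof (cases "h k d")
    case True
    have "card {k'\<in>dom ?M1. \<forall>i\<in>{Suc d..<D}. h k' i = h k i} \<le>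
      card {k'\<in>dom M. \<forall>i\<in>{d..<D}. h k' i = h k i}"
      by (intro card_mono subsetI CollectI conjI step) (use fin True in auto)
    then show ?thesis using Node.IH(2)[OF rep(2)] True by simp
  next
    case False
    have "card {k'\<in>dom ?M0. \<forall>i\<in>{Suc d..<D}. h k' i = h k i} \<le>
      card {k'\<in>dom M. \<forall>i\<in>{d..<D}. h k' i = h k i}"
      by (intro card_mono subsetI CollectI conjI step) (use fin False in auto)
    then show ?thesis using Node.IH(1)[OF rep(1)] False by simp
  qed
qed

lemma exceptions_update: "exceptions (trie_update h d k y T) = exceptions T"
  by (induction T arbitrary: d) auto

section \<open>A prefix-free binary code for tries\<close>

fun encode_exceptions :: "('k \<Rightarrow> bits) \<Rightarrow> ('k \<times> bits) list \<Rightarrow> bits" where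
  "encode_exceptions f [] = [False]"
| "encode_exceptions f (e # es) = True # f (fst e) @ snd e @ encode_exceptions f es"

text \<open>Preorder traversal with tags of one or two bits. Values and key codes have known fixed
  lengths, so they need no delimiters.\<close>

fun encode :: "('k \<Rightarrow> bits) \<Rightarrow> 'k trie \<Rightarrow> bits" where
  "encode f Empty = [False, False]"
| "encode f (Leaf x es) = [False, True] @ x @ encode_exceptions f es"
| "encode f (Node l r) = True # encode f l @ encode f r"

fun valid :: "nat \<Rightarrow> 'k set \<Rightarrow> 'k trie \<Rightarrow> bool" where
  "valid v U Empty \<longleftrightarrow> True"
| "valid v U (Leaf x es) \<longleftrightarrow> length x = v \<and> (\<forall>e\<in>set es. fst e \<in> U \<and> length (snd e) = v)"
| "valid v U (Node l r) \<longleftrightarrow> valid v U l \<and> valid v U r"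

lemma represents_valid:
  "represents h m D d T M \<Longrightarrow> dom M \<subseteq> U \<Longrightarrow> (\<And>k x. M k = Some x \<Longrightarrow> length x = v) \<Longrightarrow> valid v U T"
proof (induction T arbitrary: d M)
  case (Leaf x es)
  obtain k where k: "distinct (map fst es)" "k \<notin> fst ` set es" "M = (map_of es)(k \<mapsto> x)"
    using Leaf.prems(1) unfolding represents.simps by blast
  have "M (fst e) = Some (snd e)" if "e \<in> set es" for e
  proof -
    have "fst e \<noteq> k" using k that by auto
    then show ?thesis using k that by (cases e) simp
  qed
  moreover have "M k = Some x" using k by simp
  ultimately show ?case using Leaf.prems(2,3) unfolding valid.simps by (meson domI subsetD)
next
  case (Node l r)
  have "valid v U l"
    using Node.prems by (intro Node.IH(1)[of "Suc d" "M |` {k. \<not> h k d}"]) (auto simp: restrict_map_def split: if_splits)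
  moreover have "valid v U r"
    using Node.prems by (intro Node.IH(2)[of "Suc d" "M |` {k. h k d}"]) (auto simp: restrict_map_def split: if_splits)
  ultimately show ?case by simp
qed auto

lemma length_encode_exceptions:
  "(\<And>e. e \<in> set es \<Longrightarrow> length (f (fst e)) = \<kappa> \<and> length (snd e) = v) \<Longrightarrow>
    length (encode_exceptions f es) = 1 + length es * (1 + \<kappa> + v)"
  by (induction es) (auto simp: algebra_simps)

text \<open>There is one external node (\<open>Empty\<close> or \<open>Leaf\<close>) more than there
  are inner nodes; with 2 bits and 1 bit each, the shape takes \<open>3 * nodes T + 2\<close> bits.
  The \<open>1\<close> added to \<open>v\<close> is the list tag: the end mark of a leaf or the mark
  before an exception.\<close>

lemma length_encode:
  assumes "\<And>k. k \<in> U \<Longrightarrow> length (f k) = \<kappa>"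
  shows "valid v U T \<Longrightarrow>
    length (encode f T) = 3 * nodes T + 2 + keys T * (1 + v) + exceptions T * \<kappa>"
proof (induction T)
  case (Leaf x es)
  have "length (encode_exceptions f es) = 1 + length es * (1 + \<kappa> + v)"
    by (rule length_encode_exceptions) (use Leaf assms in auto)
  then show ?case using Leaf by (simp add: algebra_simps)
qed (auto simp: algebra_simps)

lemma encode_exceptions_inject:
  assumes "\<And>k. k \<in> U \<Longrightarrow> length (f k) = \<kappa>" "inj_on f U"
  shows "(\<And>e. e \<in> set es \<Longrightarrow> fst e \<in> U \<and> length (snd e) = v) \<Longrightarrow>
    (\<And>e. e \<in> set es' \<Longrightarrow> fst e \<in> U \<and> length (snd e) = v) \<Longrightarrow>
    encode_exceptions f es @ xs = encode_exceptions f es' @ ys \<Longrightarrow> es = es' \<and> xs = ys"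
proof (induction es arbitrary: es')
  case Nil
  then show ?case by (cases es') auto
next
  case (Cons e es)
  then obtain e' es'' where es': "es' = e' # es''" by (cases es') auto
  have e: "fst e \<in> U" "fst e' \<in> U" "length (snd e) = v" "length (snd e') = v"
    using Cons.prems(1)[of e] Cons.prems(2)[of e'] es' by auto
  have "length (f (fst e)) = length (f (fst e'))" "length (snd e) = length (snd e')" using e assms by auto
  then have eq: "f (fst e) = f (fst e')" "snd e = snd e'"
    "encode_exceptions f es @ xs = encode_exceptions f es'' @ ys"
    using Cons.prems(3) unfolding es' by auto
  have "fst e = fst e'" using eq e assms by (metis inj_onD)
  moreover have "es = es'' \<and> xs = ys" using Cons.prems(1,2) es' eq(3) by (intro Cons.IH) auto
  ultimately show ?case using eq es' by (simp add: prod_eq_iff)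
qed

text \<open>Prefix-freeness: the arbitrary strings that follow let the induction peel off the left
  subtree and continue with the right one.\<close>

lemma encode_inject:
  assumes "\<And>k. k \<in> U \<Longrightarrow> length (f k) = \<kappa>" "inj_on f U"
  shows "valid v U T \<Longrightarrow> valid v U T' \<Longrightarrow> encode f T @ xs = encode f T' @ ys \<Longrightarrow> T = T' \<and> xs = ys"
proof (induction T arbitrary: T' xs ys)
  case Empty
  then show ?case by (cases T') auto
next
  case (Leaf x es)
  then obtain x' es' where T': "T' = Leaf x' es'" by (cases T') auto
  have "x = x'" "encode_exceptions f es @ xs = encode_exceptions f es' @ ys"
    using Leaf unfolding T' by auto
  moreover from this(2) have "es = es' \<and> xs = ys"
    using Leaf.prems(1,2) unfolding T' by (intro encode_exceptions_inject[OF assms]) auto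
  ultimately show ?case using T' by simp
next
  case (Node l r)
  obtain l' r' where T': "T' = Node l' r'" using Node.prems(3) by (cases T') auto
  have "encode f l @ (encode f r @ xs) = encode f l' @ (encode f r' @ ys)"
    using Node.prems unfolding T' by simp
  then have "l = l' \<and> encode f r @ xs = encode f r' @ ys"
    using Node.prems(1,2) unfolding T' valid.simps by (intro Node.IH(1)) iprover+
  moreover from this have "r = r' \<and> xs = ys"
    using Node.prems(1,2) unfolding T' valid.simps by (intro Node.IH(2)) iprover+
  ultimately show ?case using T' by simp
qed

section \<open>Random linear hashing over GF(2)\<close>

text \<open>The inner product over GF(2); inequality of truth values is addition.\<close>

fun dot :: "bits \<Rightarrow> bits \<Rightarrow> bool" where
  "dot (a # u) (b # x) = ((a \<and> b) \<noteq> dot u x)"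
| "dot u x = False"

lemma finite_bits_length: "finite {u :: bits. length u = \<kappa>}"
  using finite_lists_length_eq[of "UNIV :: bool set" \<kappa>] by simp

lemma card_bits_length: "card {u :: bits. length u = \<kappa>} = 2 ^ \<kappa>"
  using card_lists_length_eq[of "UNIV :: bool set" \<kappa>] by (simp add: card_UNIV_bool)

text \<open>At most half of all \<open>u\<close> fail to tell \<open>x\<close> from
  \<open>y\<close>: at a position where the two differ, the bit of \<open>u\<close> is determined by
  the later ones.\<close>

lemma card_dot_collision:
  assumes "length x = length y" "x \<noteq> y"
  shows "2 * card {u. length u = length x \<and> dot u x = dot u y} \<le> 2 ^ length x"
  using assms
proof (induction x y rule: list_induct2)
  case (Cons b x b' y)
  let ?S = "{u. length u = length (b # x) \<and> dot u (b # x) = dot u (b' # y)}"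
  show ?case
  proof (cases "b = b'")
    case True
    let ?S' = "{u. length u = length x \<and> dot u x = dot u y}"
    have fin: "finite ?S'" by (rule finite_subset[OF _ finite_bits_length[of "length x"]]) auto
    have "?S \<subseteq> (\<lambda>(a, u). a # u) ` (UNIV \<times> ?S')"
    proof
      fix u assume u: "u \<in> ?S"
      then obtain a u' where "u = a # u'" by (cases u) auto
      then show "u \<in> (\<lambda>(a, u). a # u) ` (UNIV \<times> ?S')" using u True by auto
    qed
    then have "card ?S \<le> card ((\<lambda>(a, u). a # u) ` ((UNIV :: bool set) \<times> ?S'))"
      using fin by (intro card_mono) auto
    also have "\<dots> \<le> card ((UNIV :: bool set) \<times> ?S')" using fin by (intro card_image_le) auto
    also have "\<dots> = 2 * card ?S'" by (simp add: card_cartesian_product card_UNIV_bool)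
    finally show ?thesis using Cons True by simp
  next
    case False
    \<comment> \<open>Exactly one of the two products contains the first bit of \<open>u\<close>, so
      equality of the products forces its value.\<close>
    have "?S \<subseteq> (\<lambda>u. (dot u x \<noteq> dot u y) # u) ` {u. length u = length x}"
    proof
      fix u assume u: "u \<in> ?S"
      then obtain a u' where "u = a # u'" by (cases u) auto
      then show "u \<in> (\<lambda>u. (dot u x \<noteq> dot u y) # u) ` {u. length u = length x}"
        using u False by auto
    qed
    then have "card ?S \<le> card {u :: bits. length u = length x}"
      using finite_bits_length by (rule surj_card_le[rotated])
    then show ?thesis by (simp add: card_bits_length)
  qed
qed simp

text \<open>The matrices over GF(2) with \<open>m\<close> rows of \<open>\<kappa>\<close> bits, as
  lists of rows; row \<open>j\<close> produces hash bit \<open>j\<close>.\<close>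

definition seeds :: "nat \<Rightarrow> nat \<Rightarrow> bits list set" where
  "seeds m \<kappa> = {s. set s \<subseteq> {u. length u = \<kappa>} \<and> length s = m}"

definition hash :: "('k \<Rightarrow> bits) \<Rightarrow> bits list \<Rightarrow> 'k \<Rightarrow> nat \<Rightarrow> bool" where
  "hash f s k j = dot (s ! j) (f k)"

lemma finite_seeds: "finite (seeds m \<kappa>)"
  unfolding seeds_def by (rule finite_lists_length_eq[OF finite_bits_length])

lemma card_seeds: "card (seeds m \<kappa>) = 2 ^ (\<kappa> * m)"
  unfolding seeds_def by (simp add: card_lists_length_eq finite_bits_length card_bits_length power_mult)

lemma length_concat_seed: "s \<in> seeds m \<kappa> \<Longrightarrow> length (concat s) = m * \<kappa>"
  unfolding seeds_def by (auto, induction s arbitrary: m) auto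

lemma concat_seed_inject:
  "s \<in> seeds m \<kappa> \<Longrightarrow> s' \<in> seeds m \<kappa> \<Longrightarrow> concat s @ xs = concat s' @ ys \<Longrightarrow> s = s' \<and> xs = ys"
proof (induction s arbitrary: s' m)
  case Nil
  then show ?case by (auto simp: seeds_def)
next
  case (Cons u s)
  then obtain u' t' where s': "s' = u' # t'" by (cases s') (auto simp: seeds_def)
  have m: "s \<in> seeds (m - 1) \<kappa>" "t' \<in> seeds (m - 1) \<kappa>" and "length u = length u'"
    using Cons.prems unfolding s' by (auto simp: seeds_def)
  then have "u = u'" "concat s @ xs = concat t' @ ys" using Cons.prems(3) s' by auto
  then show ?case using Cons.IH[OF m] s' by simp
qed

text \<open>The rows are independent, and each of the first \<open>j\<close> fails to separate the
  keys with probability at most 1/2.\<close>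

lemma card_hash_collision:
  assumes "length (f k) = \<kappa>" "length (f k') = \<kappa>" "f k \<noteq> f k'" "j \<le> m"
  shows "real (card {s \<in> seeds m \<kappa>. \<forall>i<j. hash f s k i = hash f s k' i}) \<le> real (card (seeds m \<kappa>)) / 2 ^ j"
proof -
  define G where "G = {u. length u = \<kappa> \<and> dot u (f k) = dot u (f k')}"
  have G: "2 * card G \<le> 2 ^ \<kappa>" using card_dot_collision[of "f k" "f k'"] assms unfolding G_def by simp
  have finG: "finite G" unfolding G_def by (rule finite_subset[OF _ finite_bits_length[of \<kappa>]]) auto
  let ?A = "{xs. set xs \<subseteq> G \<and> length xs = j}" and ?S = "{s \<in> seeds m \<kappa>. \<forall>i<j. hash f s k i = hash f s k' i}"
  have finA: "finite ?A" using finG by (rule finite_lists_length_eq)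
  \<comment> \<open>The first \<open>j\<close> rows must lie in \<open>G\<close>; the others are
    free.\<close>
  have "?S \<subseteq> (\<lambda>(xs, ys). xs @ ys) ` (?A \<times> seeds (m - j) \<kappa>)"
  proof
    fix s assume s: "s \<in> ?S"
    then have "s ! i \<in> G" if "i < j" for i
      using that assms(4) unfolding G_def seeds_def hash_def by (auto simp: subset_iff)
    then have "take j s \<in> ?A" using s assms(4) by (auto simp: in_set_conv_nth seeds_def)
    moreover have "drop j s \<in> seeds (m - j) \<kappa>" using s set_drop_subset[of j s] by (auto simp: seeds_def)
    ultimately show "s \<in> (\<lambda>(xs, ys). xs @ ys) ` (?A \<times> seeds (m - j) \<kappa>)"
      by (intro image_eqI[of _ _ "(take j s, drop j s)"]) auto
  qed
  then have "card ?S \<le> card (?A \<times> seeds (m - j) \<kappa>)"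
    using finA finite_seeds by (intro surj_card_le) auto
  also have "\<dots> = card G ^ j * 2 ^ (\<kappa> * (m - j))"
    using finG by (simp add: card_cartesian_product card_seeds card_lists_length_eq)
  finally have "2 ^ j * card ?S \<le> (2 * card G) ^ j * 2 ^ (\<kappa> * (m - j))" by (simp add: power_mult_distrib)
  also have "\<dots> \<le> (2 ^ \<kappa>) ^ j * 2 ^ (\<kappa> * (m - j))" using G by (intro mult_right_mono power_mono) auto
  also have "\<dots> = 2 ^ (\<kappa> * m)" using assms(4)
    by (simp add: power_mult[symmetric] power_add[symmetric] add_mult_distrib2[symmetric])
  finally have "2 ^ j * card ?S \<le> card (seeds m \<kappa>)" by (simp add: card_seeds)
  then have "real (2 ^ j * card ?S) \<le> real (card (seeds m \<kappa>))" by (simp only: of_nat_le_iff)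
  then show ?thesis by (simp add: field_simps)
qed

text \<open>Double counting. Expectations over the seed appear as plain sums over all seeds, and
  this is their linearity.\<close>

lemma sum_card_filter_swap:
  assumes "finite S" "finite A"
  shows "(\<Sum>s\<in>S. real (card {p\<in>A. P s p})) = (\<Sum>p\<in>A. real (card {s\<in>S. P s p}))"
proof -
  have "(\<Sum>s\<in>S. real (card {p\<in>A. P s p})) = (\<Sum>s\<in>S. \<Sum>p\<in>A. of_bool (P s p))"
    using assms by (simp add: Collect_conj_eq)
  also have "\<dots> = (\<Sum>p\<in>A. \<Sum>s\<in>S. of_bool (P s p))" by (rule sum.swap)
  also have "\<dots> = (\<Sum>p\<in>A. real (card {s\<in>S. P s p}))"
    using assms by (simp add: Collect_conj_eq)
  finally show ?thesis .
qed

lemma sum_half_powers_le: "(\<Sum>j = d..<m. 1 / 2 ^ j) \<le> 2 / (2::real) ^ d"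
proof -
  have "(\<Sum>j = d..<d + e. 1 / 2 ^ j) = 2 / 2 ^ d - 2 / (2::real) ^ (d + e)" for e
  proof (induction e)
    case (Suc e)
    have "2 / (2::real) ^ (d + e) = 2 / 2 ^ (d + Suc e) + 1 / 2 ^ (d + e)" by simp
    then show ?case using Suc by simp
  qed simp
  from this[of "m - d"] show ?thesis by (cases "d \<le> m") auto
qed

section \<open>Legal sequences of operations\<close>

lemma contents_snoc: "contents (as @ [a]) = apply_op (contents as) a"
  by (simp add: contents_def)

lemma legal_from_append:
  "legal_from n v U M (as @ bs) \<longleftrightarrow> legal_from n v U M as \<and> legal_from n v U (foldl apply_op M as) bs"
  by (induction as arbitrary: M) auto

lemma legal_snoc: "legal n v U (as @ [a]) \<longleftrightarrow> legal n v U as \<and> legal_op n v U (contents as) a"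
  by (simp add: legal_def contents_def legal_from_append)

lemma legal_contents:
  "legal n v U as \<Longrightarrow> dom (contents as) \<subseteq> U \<and> finite (dom (contents as)) \<and>
    card (dom (contents as)) \<le> n \<and> (\<forall>k x. contents as k = Some x \<longrightarrow> length x = v)"
proof (induction as rule: rev_induct)
  case Nil
  then show ?case by (simp add: contents_def)
next
  case (snoc a as)
  then have IH: "dom (contents as) \<subseteq> U" "finite (dom (contents as))" "card (dom (contents as)) \<le> n"
    "\<forall>k x. contents as k = Some x \<longrightarrow> length x = v" and a: "legal_op n v U (contents as) a"
    by (auto simp: legal_snoc)
  show ?case
  proof (cases a)
    case (Insert k x)
    then have "dom (contents (as @ [a])) = insert k (dom (contents as))" by (simp add: contents_snoc)
    moreover have "\<forall>k x. contents (as @ [a]) k = Some x \<longrightarrow> length x = v"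
      using IH(4) a Insert by (simp add: contents_snoc)
    ultimately show ?thesis using IH a Insert by (simp add: card_insert_if)
  next
    case (Update k x)
    then have "dom (contents (as @ [a])) = dom (contents as)" using a by (auto simp: contents_snoc)
    moreover have "\<forall>k x. contents (as @ [a]) k = Some x \<longrightarrow> length x = v"
      using IH(4) a Update by (simp add: contents_snoc)
    ultimately show ?thesis using IH by simp
  qed
qed

section \<open>The data structure for given cut-off depths and its expected size\<close>

text \<open>\<open>D i\<close> is the cut-off depth when \<open>i\<close> keys are present. The code
  \<open>f\<close> of the keys is a fixed parameter and takes no memory; only the seed and the trie
  are stored.\<close>

locale hashed_trie =
  fixes n v :: nat and U :: "'k set" and f :: "'k \<Rightarrow> bits" and \<kappa> m l :: nat and D :: "nat \<Rightarrow> nat"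
  assumes length_f: "\<And>k. k \<in> U \<Longrightarrow> length (f k) = \<kappa>"
    and inj_f: "inj_on f U"
    and D_le: "\<And>i. D i \<le> m" and D_ge: "\<And>i. l \<le> D i" and D_Suc: "\<And>i. D (Suc i) \<le> D i"
    and n_le: "n \<le> 2 ^ l"
begin

definition store :: "bits list \<times> 'k trie \<Rightarrow> bits" where
  "store = (\<lambda>(s, T). concat s @ encode f T)"

definition states :: "(bits list \<times> 'k trie) set" where
  "states = seeds m \<kappa> \<times> {T. valid v U T}"

text \<open>Decoding is the abstract inverse of \<open>store\<close> on valid states, which suffices
  because running times are not modelled.\<close>

definition load :: "bits \<Rightarrow> bits list \<times> 'k trie" where
  "load = inv_into states store"

text \<open>The depth belongs to the number of keys after the insertion, and the old branches are
  cut to it first.\<close>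

fun step :: "bits list \<Rightarrow> 'k operation \<Rightarrow> 'k trie \<Rightarrow> 'k trie" where
  "step s (Insert k x) T = trie_insert (hash f s) (D (Suc (keys T))) 0 k x (prune (D (Suc (keys T))) 0 T)"
| "step s (Update k x) T = trie_update (hash f s) 0 k x T"

definition exec :: "'k operation \<Rightarrow> bits \<Rightarrow> bits pmf" where
  "exec a b = return_pmf (case load b of (s, T) \<Rightarrow> store (s, step s a T))"

definition DS :: "'k retrieval_ds" where
  "DS = \<lparr>ds_init = map_pmf (\<lambda>s. store (s, Empty)) (pmf_of_set (seeds m \<kappa>)),
    ds_insert = (\<lambda>k x. exec (Insert k x)),
    ds_update = (\<lambda>k x. exec (Update k x)),
    ds_query = (\<lambda>k b. case load b of (s, T) \<Rightarrow> lookup (hash f s) 0 T k)\<rparr>"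

definition run :: "bits list \<Rightarrow> 'k operation list \<Rightarrow> 'k trie" where
  "run s as = foldl (\<lambda>T a. step s a T) Empty as"

lemma run_snoc: "run s (as @ [a]) = step s a (run s as)"
  by (simp add: run_def)

lemma load_store: "s \<in> seeds m \<kappa> \<Longrightarrow> valid v U T \<Longrightarrow> load (store (s, T)) = (s, T)"
proof -
  assume a: "s \<in> seeds m \<kappa>" "valid v U T"
  have "inj_on store states"
  proof (rule inj_onI)
    fix p q assume pq: "p \<in> states" "q \<in> states" "store p = store q"
    obtain s T s' T' where p: "p = (s, T)" "q = (s', T')" by (cases p, cases q)
    have s: "s = s' \<and> encode f T = encode f T'"
      using pq unfolding p by (intro concat_seed_inject[of _ m \<kappa>]) (auto simp: states_def store_def)
    have "T = T' \<and> ([] :: bits) = []"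
      using pq s unfolding p by (intro encode_inject[OF length_f inj_f, where v = v]) (auto simp: states_def)
    then show "p = q" using s p by simp
  qed
  then show ?thesis using a by (simp add: load_def states_def)
qed

text \<open>This holds for every \<open>s\<close>, so queries never err; the random choice affects
  only the size.\<close>

lemma run_represents:
  "legal n v U as \<Longrightarrow>
    represents (hash f s) m (D (card (dom (contents as)))) 0 (run s as) (contents as)"
proof (induction as rule: rev_induct)
  case Nil
  then show ?case by (simp add: contents_def run_def)
next
  case (snoc a as)
  then have IH: "represents (hash f s) m (D (card (dom (contents as)))) 0 (run s as) (contents as)"
    and a: "legal_op n v U (contents as) a" and fin: "finite (dom (contents as))"
    using legal_contents by (auto simp: legal_snoc)
  have keys: "keys (run s as) = card (dom (contents as))" using represents_keys[OF IH] .
  show ?case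
  proof (cases a)
    case (Insert k x)
    then have k: "k \<notin> dom (contents as)" using a by simp
    then have "card (dom (contents (as @ [a]))) = Suc (card (dom (contents as)))"
      using fin Insert by (simp add: contents_snoc)
    then show ?thesis
      using represents_insert[OF represents_prune[OF IH D_Suc] k D_le] Insert keys
      by (simp only: run_snoc contents_snoc step.simps apply_op.simps)
  next
    case (Update k x)
    then have k: "k \<in> dom (contents as)" using a by simp
    then have "dom (contents (as @ [a])) = dom (contents as)" using Update by (auto simp: contents_snoc)
    then show ?thesis using represents_update[OF IH k] Update
      by (simp only: run_snoc contents_snoc step.simps apply_op.simps)
  qed
qed

lemma run_valid:
  assumes "legal n v U as"
  shows "valid v U (run s as)"
  using legal_contents[OF assms] by (intro represents_valid[OF run_represents[OF assms]]) auto

lemma seeds_nonempty: "seeds m \<kappa> \<noteq> {}"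
  using card_seeds[of m \<kappa>] by (metis card.empty power_not_zero zero_neq_numeral)

text \<open>Only the initialisation is random. The operations are fixed in advance and keep the
  seed, so it stays uniform and expectations become averages over
  \<open>seeds m \<kappa>\<close>.\<close>

lemma memory_after_DS:
  "legal n v U as \<Longrightarrow> memory_after DS as = map_pmf (\<lambda>s. store (s, run s as)) (pmf_of_set (seeds m \<kappa>))"
proof (induction as rule: rev_induct)
  case Nil
  then show ?case by (simp add: memory_after_def DS_def run_def)
next
  case (snoc a as)
  then have legal: "legal n v U as" by (simp add: legal_snoc)
  have exec: "exec_op DS a = exec a" by (cases a) (auto simp: DS_def fun_eq_iff)
  have "memory_after DS (as @ [a]) = bind_pmf (memory_after DS as) (exec a)"
    by (simp add: memory_after_def exec)
  also have "\<dots> = bind_pmf (pmf_of_set (seeds m \<kappa>)) (\<lambda>s. exec a (store (s, run s as)))"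
    using snoc.IH[OF legal] by (simp add: bind_map_pmf)
  also have "\<dots> = bind_pmf (pmf_of_set (seeds m \<kappa>)) (\<lambda>s. return_pmf (store (s, run s (as @ [a]))))"
    using finite_seeds seeds_nonempty run_valid[OF legal]
    by (intro bind_pmf_cong) (auto simp: exec_def load_store run_snoc)
  finally show ?case by (simp add: map_pmf_def)
qed

lemma incremental_retrieval_DS: "incremental_retrieval n v U DS"
  unfolding incremental_retrieval_def
proof (intro allI impI ballI)
  fix as b k x assume as: "legal n v U as" "b \<in> set_pmf (memory_after DS as)" "contents as k = Some x"
  then obtain s where "s \<in> seeds m \<kappa>" "b = store (s, run s as)"
    using finite_seeds seeds_nonempty by (auto simp: memory_after_DS)
  then show "ds_query DS k b = x"
    using represents_lookup[OF run_represents[OF as(1)] as(3)] run_valid[OF as(1)]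
    by (simp add: DS_def load_store)
qed

lemma card_collision_seeds:
  assumes "k \<in> U" "k' \<in> U" "k \<noteq> k'" "j \<le> m"
  shows "real (card {s \<in> seeds m \<kappa>. \<forall>i\<in>{0..<j}. hash f s k i = hash f s k' i}) \<le>
    real (card (seeds m \<kappa>)) / 2 ^ j"
proof -
  have "f k \<noteq> f k'" using assms inj_f by (auto dest: inj_onD)
  then show ?thesis using card_hash_collision[of f k \<kappa> k' j m] assms length_f by (simp add: Ball_def)
qed

text \<open>The insertion that brings the number of keys to \<open>Suc j\<close> works at depth
  \<open>D (Suc j)\<close>. It meets at most \<open>n\<close> older keys, each agreeing with the new
  one up to that depth with probability at most \<open>1 / 2 ^ D (Suc j)\<close>.\<close>

lemma sum_exceptions_le:
  "legal n v U as \<Longrightarrow> (\<Sum>s\<in>seeds m \<kappa>. real (exceptions (run s as))) \<le>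
    real (card (seeds m \<kappa>)) * (\<Sum>j<card (dom (contents as)). real n / 2 ^ D (Suc j))"
proof (induction as rule: rev_induct)
  case Nil
  then show ?case by (simp add: run_def contents_def)
next
  case (snoc a as)
  then have legal: "legal n v U as" and a: "legal_op n v U (contents as) a"
    by (auto simp: legal_snoc)
  note IH = snoc.IH[OF legal]
  let ?K = "dom (contents as)"
  have K: "?K \<subseteq> U" "finite ?K" "card ?K \<le> n" using legal_contents[OF legal] by auto
  show ?case
  proof (cases a)
    case (Insert k x)
    then have k: "k \<notin> ?K" "k \<in> U" using a by auto
    then have card: "card (dom (contents (as @ [a]))) = Suc (card ?K)"
      using K Insert by (simp add: contents_snoc)
    define d where "d = D (Suc (card ?K))"
    have "exceptions (run s (as @ [a])) \<le> exceptions (run s as) +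
        card {k'\<in>?K. \<forall>i\<in>{0..<d}. hash f s k' i = hash f s k i}" for s
    proof -
      note rep = run_represents[OF legal, of s]
      have "represents (hash f s) m d 0 (prune d 0 (run s as)) (contents as)"
        unfolding d_def by (rule represents_prune[OF rep D_Suc])
      note exceptions_insert[OF this, of k x]
      also have "exceptions (prune d 0 (run s as)) \<le> exceptions (run s as)" by (rule exceptions_prune)
      finally show ?thesis by (simp add: run_snoc Insert represents_keys[OF rep] d_def)
    qed
    then have "(\<Sum>s\<in>seeds m \<kappa>. real (exceptions (run s (as @ [a])))) \<le>
      (\<Sum>s\<in>seeds m \<kappa>. real (exceptions (run s as)) +
        real (card {k'\<in>?K. \<forall>i\<in>{0..<d}. hash f s k' i = hash f s k i}))"
      by (intro sum_mono) (simp only: of_nat_add[symmetric] of_nat_le_iff)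
    also have "\<dots> = (\<Sum>s\<in>seeds m \<kappa>. real (exceptions (run s as))) +
      (\<Sum>k'\<in>?K. real (card {s\<in>seeds m \<kappa>. \<forall>i\<in>{0..<d}. hash f s k' i = hash f s k i}))"
      using K by (simp only: sum.distrib sum_card_filter_swap[OF finite_seeds])
    also have "(\<Sum>k'\<in>?K. real (card {s\<in>seeds m \<kappa>. \<forall>i\<in>{0..<d}. hash f s k' i = hash f s k i})) \<le>
      (\<Sum>k'\<in>?K. real (card (seeds m \<kappa>)) / 2 ^ d)"
      using K k D_le by (intro sum_mono card_collision_seeds) (auto simp: d_def)
    also have "\<dots> = real (card (seeds m \<kappa>)) * (real (card ?K) / 2 ^ d)" by simp
    also have "\<dots> \<le> real (card (seeds m \<kappa>)) * (real n / 2 ^ d)"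
      using K by (intro mult_left_mono divide_right_mono) auto
    finally show ?thesis using IH by (simp add: card d_def algebra_simps)
  next
    case (Update k x)
    then have "dom (contents (as @ [a])) = ?K" using a by (auto simp: contents_snoc)
    moreover have "exceptions (run s (as @ [a])) = exceptions (run s as)" for s
      by (simp add: run_snoc Update exceptions_update)
    ultimately show ?thesis using IH by simp
  qed
qed

text \<open>At most \<open>n\<^sup>2\<close> ordered pairs, each surviving to level \<open>j\<close>
  with probability at most \<open>1 / 2 ^ j\<close>. Summing over \<open>j \<ge> l\<close> gives a
  factor \<open>2 / 2 ^ l\<close>, and \<open>n \<le> 2 ^ l\<close> leaves
  \<open>2 * n\<close>.\<close>

lemma sum_collisions_le:
  assumes K: "K \<subseteq> U" "finite K" "card K \<le> n" and d: "l \<le> d"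
  shows "(\<Sum>s\<in>seeds m \<kappa>. real (card (collisions (hash f s) m d 0 K))) \<le>
    real (card (seeds m \<kappa>)) * (2 * real n)"
proof -
  define A where "A = {(k, k', j). k \<in> K \<and> k' \<in> K \<and> k \<noteq> k' \<and> d \<le> j \<and> j < m}"
  have A: "A \<subseteq> K \<times> K \<times> {d..<m}" by (auto simp: A_def)
  have finA: "finite A" by (rule finite_subset[OF A]) (use K in auto)
  define P where "P s = (\<lambda>(k, k', j). \<forall>i\<in>{0..<j}. hash f s k i = hash f s k' i)" for s
  have "collisions (hash f s) m d 0 K = {p\<in>A. P s p}" for s
    by (auto simp: collisions_def A_def P_def)
  then have "(\<Sum>s\<in>seeds m \<kappa>. real (card (collisions (hash f s) m d 0 K))) =
      (\<Sum>p\<in>A. real (card {s\<in>seeds m \<kappa>. P s p}))"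
    by (simp only: sum_card_filter_swap[OF finite_seeds finA])
  also have "\<dots> \<le> (\<Sum>p\<in>A. real (card (seeds m \<kappa>)) / 2 ^ snd (snd p))"
  proof (rule sum_mono)
    fix p assume p: "p \<in> A"
    obtain k k' j where p': "p = (k, k', j)" by (cases p)
    show "real (card {s\<in>seeds m \<kappa>. P s p}) \<le> real (card (seeds m \<kappa>)) / 2 ^ snd (snd p)"
      using card_collision_seeds[of k k' j] p K unfolding p' P_def A_def by auto
  qed
  also have "\<dots> \<le> (\<Sum>p\<in>K \<times> K \<times> {d..<m}. real (card (seeds m \<kappa>)) / 2 ^ snd (snd p))"
    using K by (intro sum_mono2 A) auto
  also have "\<dots> = (\<Sum>k\<in>K. \<Sum>k'\<in>K. \<Sum>j = d..<m. real (card (seeds m \<kappa>)) / 2 ^ j)"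
    by (simp only: sum.cartesian_product) (simp add: split_beta)
  also have "\<dots> = real (card (seeds m \<kappa>)) * (real (card K) * (real (card K) * (\<Sum>j = d..<m. 1 / 2 ^ j)))"
    by (simp add: sum_distrib_left algebra_simps)
  also have "\<dots> \<le> real (card (seeds m \<kappa>)) * (real n * (real n * (2 / 2 ^ l)))"
  proof -
    have "(\<Sum>j = d..<m. 1 / 2 ^ j) \<le> 2 / (2::real) ^ d" by (rule sum_half_powers_le)
    also have "\<dots> \<le> 2 / 2 ^ l" using d by (intro divide_left_mono power_increasing) auto
    finally show ?thesis using K by (intro mult_left_mono mult_mono sum_nonneg mult_nonneg_nonneg) auto
  qed
  also have "\<dots> \<le> real (card (seeds m \<kappa>)) * (2 * real n)"
  proof -
    have "real n \<le> 2 ^ l" using n_le by (metis of_nat_le_iff of_nat_numeral of_nat_power)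
    then have "real n * (2 / 2 ^ l) \<le> 2" by (simp add: field_simps)
    then have "real n * (real n * (2 / 2 ^ l)) \<le> real n * 2" by (intro mult_left_mono) auto
    then show ?thesis by (intro mult_left_mono) auto
  qed
  finally show ?thesis .
qed

text \<open>In this order: the seed, three bits per inner node above the cut-off, three bits for
  each of the expected \<open>2 * n\<close> collisions, the final 2 of the shape code, the values
  with their tags, and the codes of the exceptional keys.\<close>

lemma expected_size_DS_le:
  assumes legal: "legal n v U as"
  defines "i \<equiv> card (dom (contents as))"
  shows "expected_size DS as \<le> ennreal (real (m * \<kappa>) + 3 * real (2 ^ l + i * (D i - l)) + 6 * real n + 2 +
    real (i * (1 + v)) + real \<kappa> * (\<Sum>j<i. real n / 2 ^ D (Suc j)))" (is "_ \<le> ennreal ?B")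
proof -
  let ?S = "seeds m \<kappa>"
  define C where "C s = card (collisions (hash f s) m (D i) 0 (dom (contents as)))" for s
  define B where "B = real (m * \<kappa>) + 3 * real (2 ^ l + i * (D i - l)) + 2 + real (i * (1 + v))"
  have len: "real (length (store (s, run s as))) \<le> B + 3 * real (C s) + real \<kappa> * real (exceptions (run s as))"
    if "s \<in> ?S" for s
  proof -
    have rep: "represents (hash f s) m (D i) 0 (run s as) (contents as)"
      unfolding i_def by (rule run_represents[OF legal])
    have "nodes (run s as) \<le> 2 ^ l + i * (D i - l) + C s"
      using nodes_le[OF rep D_ge[of i]] unfolding C_def i_def by simp
    moreover have "length (store (s, run s as)) =
        m * \<kappa> + (3 * nodes (run s as) + 2 + i * (1 + v) + exceptions (run s as) * \<kappa>)"
      using length_encode[OF length_f run_valid[OF legal], where s1 = s] length_concat_seed[OF that]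
        represents_keys[OF rep] by (simp add: store_def i_def)
    ultimately have "length (store (s, run s as)) \<le>
        m * \<kappa> + 3 * (2 ^ l + i * (D i - l)) + 2 + i * (1 + v) + 3 * C s + \<kappa> * exceptions (run s as)"
      by (simp add: algebra_simps)
    then have "real (length (store (s, run s as))) \<le>
        real (m * \<kappa> + 3 * (2 ^ l + i * (D i - l)) + 2 + i * (1 + v) + 3 * C s + \<kappa> * exceptions (run s as))"
      by (simp only: of_nat_le_iff)
    then show ?thesis unfolding B_def by (simp only: of_nat_add of_nat_mult of_nat_numeral)
  qed
  have "(\<Sum>s\<in>?S. real (length (store (s, run s as)))) \<le>
      (\<Sum>s\<in>?S. B + 3 * real (C s) + real \<kappa> * real (exceptions (run s as)))"
    by (intro sum_mono len)
  also have "\<dots> = real (card ?S) * B + 3 * (\<Sum>s\<in>?S. real (C s)) +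
      real \<kappa> * (\<Sum>s\<in>?S. real (exceptions (run s as)))"
    by (simp add: sum.distrib sum_distrib_left)
  also have "\<dots> \<le> real (card ?S) * B + 3 * (real (card ?S) * (2 * real n)) +
      real \<kappa> * (real (card ?S) * (\<Sum>j<i. real n / 2 ^ D (Suc j)))"
    using sum_exceptions_le[OF legal] sum_collisions_le[OF _ _ _ D_ge[of i]] legal_contents[OF legal]
    unfolding C_def i_def by (intro add_mono mult_left_mono) auto
  also have "\<dots> = real (card ?S) * ?B" by (simp add: B_def algebra_simps)
  finally have sum: "(\<Sum>s\<in>?S. real (length (store (s, run s as)))) \<le> real (card ?S) * ?B" .
  have pos: "0 < card ?S" using finite_seeds seeds_nonempty by (simp add: card_gt_0_iff)
  have "expected_size DS as = (\<Sum>s\<in>?S. of_nat (length (store (s, run s as)))) / of_nat (card ?S)"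
    unfolding expected_size_def memory_after_DS[OF legal]
    by (simp add: nn_integral_pmf_of_set[OF seeds_nonempty finite_seeds])
  also have "\<dots> = ennreal ((\<Sum>s\<in>?S. real (length (store (s, run s as)))) / real (card ?S))"
    using pos by (simp add: ennreal_of_nat_eq_real_of_nat sum_ennreal divide_ennreal sum_nonneg)
  also have "\<dots> \<le> ennreal ?B"
    using sum pos by (intro ennreal_leI) (simp add: field_simps)
  finally show ?thesis .
qed

end

section \<open>Choice of the parameters and numerical estimates\<close>

text \<open>Supplies the rounded-up logarithm of \<open>x / w\<close>; minimality of the exponent
  gives the factor 2.\<close>

lemma ex_scaled_power_two:
  fixes w x :: nat
  assumes "1 \<le> w" "w \<le> x"
  shows "\<exists>t. x \<le> w * 2 ^ t \<and> w * 2 ^ t \<le> 2 * x"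
proof -
  have ex: "x \<le> w * 2 ^ x" using assms by (metis less_exp less_imp_le mult_le_mono nat_mult_1)
  define t where "t = (LEAST t. x \<le> w * 2 ^ t)"
  have t: "x \<le> w * 2 ^ t" unfolding t_def using ex by (rule LeastI)
  have "w * 2 ^ t \<le> 2 * x"
  proof (cases t)
    case 0
    then show ?thesis using assms by simp
  next
    case (Suc t')
    then have "t' < (LEAST t. x \<le> w * 2 ^ t)" unfolding t_def by simp
    then have "\<not> x \<le> w * 2 ^ t'" by (rule not_less_Least)
    then show ?thesis using Suc by simp
  qed
  with t show ?thesis by blast
qed

text \<open>With \<open>2 ^ t\<close> of order \<open>n\<close>, this makes a seed of O(log n) times
  O(log n) bits cost only O(n).\<close>

lemma Suc_square_le_power_two: "(t + 1)\<^sup>2 \<le> 4 * 2 ^ t" for t :: nat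
proof (induction t)
  case (Suc t)
  show ?case
  proof (cases "t < 2")
    case True
    then have "t = 0 \<or> t = 1" by linarith
    then show ?thesis by (auto simp: power2_eq_square)
  next
    case False
    then have "2 * 2 \<le> t * t" by (intro mult_le_mono) auto
    then have "(Suc t + 1)\<^sup>2 \<le> 2 * (t + 1)\<^sup>2" by (simp add: power2_eq_square)
    then show ?thesis using Suc by simp
  qed
qed simp

text \<open>A geometric series with ratio \<open>2\<close> to the power \<open>- w / N\<close>, up
  to a factor 2 for rounding the exponents down; its sum is of order
  \<open>1 + N / w\<close>.\<close>

lemma weighted_power_sum_le:
  assumes w: "1 \<le> w" and N: "1 \<le> (N::nat)"
  shows "real w * (\<Sum>r<n. 1 / 2 ^ (r * w div N)) \<le> 2 * real w + 4 * real N"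
proof -
  \<comment> \<open>Chosen so that \<open>exp (- y)\<close> is that ratio.\<close>
  define y where "y = real w * ln 2 / real N"
  have y: "0 < y" using w N by (simp add: y_def)
  have half: "1 / 2 ^ (r * w div N) \<le> 2 * exp (- y) ^ r" for r
  proof -
    have "r * w \<le> (r * w div N + 1) * N"
      using div_mult_mod_eq[of "r * w" N] mod_less_divisor[of N "r * w"] N
      by (simp only: add_mult_distrib mult_1) linarith
    then have "real (r * w) \<le> real ((r * w div N + 1) * N)" by (simp only: of_nat_le_iff)
    then have "real (r * w) / real N \<le> real (r * w div N) + 1"
      using N by (simp add: field_simps)
    then have "real (r * w) / real N * ln 2 \<le> (real (r * w div N) + 1) * ln 2"
      by (rule mult_right_mono) simp
    then have "real r * y \<le> (real (r * w div N) + 1) * ln 2" by (simp add: y_def mult.assoc)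
    then have "exp (real r * y) \<le> exp (real (r * w div N) * ln 2 + ln 2)" by (simp add: algebra_simps)
    also have "\<dots> = 2 ^ (r * w div N) * 2"
      by (simp add: exp_add exp_of_nat_mult)
    finally have "exp (real r * y) \<le> 2 ^ (r * w div N) * 2" .
    moreover have "exp (- y) ^ r = 1 / exp (real r * y)"
      by (simp add: exp_of_nat_mult exp_minus inverse_eq_divide power_one_over)
    moreover have "1 / 2 ^ (r * w div N) = 2 / (2 ^ (r * w div N) * (2::real))" by simp
    moreover have "2 / (2 ^ (r * w div N) * 2) \<le> 2 / exp (real r * y)"
      using calculation(1) by (intro divide_left_mono) auto
    ultimately show ?thesis by simp
  qed
  have "(1 + y) * exp (- y) \<le> 1"
    using exp_ge_add_one_self[of y] by (simp add: exp_minus field_simps)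
  then have "y \<le> (1 - exp (- y)) * (1 + y)" by (simp add: algebra_simps)
  then have gap: "1 / (1 - exp (- y)) \<le> 1 + 1 / y" using y by (simp add: field_simps)
  have "(\<Sum>r<n. exp (- y) ^ r) = (1 - exp (- y) ^ n) / (1 - exp (- y))"
    using y by (subst sum_gp_strict) auto
  also have "\<dots> \<le> 1 / (1 - exp (- y))" using y by (intro divide_right_mono) auto
  also note gap
  finally have geo: "(\<Sum>r<n. exp (- y) ^ r) \<le> 1 + 1 / y" .
  have "(\<Sum>r<n. 1 / 2 ^ (r * w div N)) \<le> (\<Sum>r<n. 2 * exp (- y) ^ r)" by (intro sum_mono half)
  also have "\<dots> \<le> 2 * (1 + 1 / y)" using geo by (simp add: sum_distrib_left[symmetric])
  finally have "real w * (\<Sum>r<n. 1 / 2 ^ (r * w div N)) \<le> real w * (2 * (1 + 1 / y))"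
    by (intro mult_left_mono) auto
  also have "\<dots> = 2 * real w + 2 * real N / ln 2" using w N by (simp add: y_def field_simps)
  also have "2 * real N / ln 2 \<le> 4 * real N"
  proof -
    have "1 / 2 \<le> ln (2::real)" using ln2_ge_two_thirds by simp
    then have "real N * (1 / 2) \<le> real N * ln 2" by (intro mult_left_mono) auto
    then show ?thesis by (simp add: field_simps)
  qed
  finally show ?thesis by simp
qed

text \<open>\<open>2 ^ t\<close> is at most twice \<open>\<kappa> / w\<close>. For
  \<open>n \<ge> 2\<close>, \<open>l \<le> 1 + log 2 n \<le> 2 * log 2 n\<close> gives
  \<open>\<kappa> \<le> A * log 2 n\<close>, which explains \<open>A\<close>. If
  \<open>\<kappa> \<le> v\<close>, then \<open>w = \<kappa>\<close> and
  \<open>t \<le> 1\<close>.\<close>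

lemma key_length_ratio:
  fixes a c n v l t \<kappa> w :: nat
  defines "A \<equiv> real (a + 2 * c + 1)"
  assumes n: "1 \<le> n" and v: "1 \<le> v" and l: "2 ^ l \<le> 2 * n"
    and \<kappa>: "\<kappa> = a + c * l + 1" and w: "w = min v \<kappa>" and t: "w * 2 ^ t \<le> 2 * \<kappa>"
  shows "real t \<le> 1 + log 2 A + max (log 2 (log 2 (real n) / real v)) 0"
proof (cases "\<kappa> \<le> v")
  case True
  then have "\<kappa> * 2 ^ t \<le> \<kappa> * 2" using t w by (simp add: mult.commute)
  then have "2 ^ t \<le> (2::nat) ^ 1" using \<kappa> by (simp only: mult_le_cancel1 power_one_right)
  then have "t \<le> 1" by (rule power_le_imp_le_exp[rotated]) simp
  moreover have "0 \<le> log 2 A" unfolding A_def by simp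
  ultimately show ?thesis by simp
next
  case False
  then have "v * 2 ^ t \<le> 2 * \<kappa>" using t w by simp
  then have "real (v * 2 ^ t) \<le> real (2 * \<kappa>)" by (simp only: of_nat_le_iff)
  then have t': "2 ^ t \<le> 2 * (real \<kappa> / real v)" using v by (simp add: field_simps)
  have A: "1 \<le> A" unfolding A_def by simp
  have l': "real l \<le> 1 + log 2 (real n)"
  proof -
    have "real (2 ^ l) \<le> real (2 * n)" using l by (simp only: of_nat_le_iff)
    then have "log 2 (2 ^ l) \<le> log 2 (2 * real n)" using n by (subst log_le_cancel_iff) auto
    then show ?thesis using n by (simp add: log_mult log_nat_power)
  qed
  have log_t: "real t = log 2 (2 ^ t)" by (simp add: log_nat_power)
  show ?thesis
  \<comment> \<open>For \<open>n = 1\<close> the logarithm vanishes and cannot absorb constants, but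
    then \<open>\<kappa> \<le> A\<close> outright.\<close>
  proof (cases "n = 1")
    case True
    then have "l \<le> 1" using l' by simp
    then have "c * l \<le> c * 1" by (intro mult_le_mono2)
    then have "\<kappa> \<le> a + 2 * c + 1" unfolding \<kappa> by linarith
    then have "real \<kappa> \<le> A" unfolding A_def by (simp only: of_nat_le_iff)
    then have "real \<kappa> / real v \<le> A / 1" using v by (intro frac_le) auto
    then have "2 ^ t \<le> 2 * A" using t' by simp
    then have "real t \<le> log 2 (2 * A)" unfolding log_t using A by (subst log_le_cancel_iff) auto
    then show ?thesis using A by (simp add: log_mult)
  next
    case False
    then have "2 \<le> real n" using n by simp
    then have L: "1 \<le> log 2 (real n)" by simp
    have "real \<kappa> \<le> real (a + 1) * log 2 (real n) + real c * (2 * log 2 (real n))"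
    proof -
      have "real (a + 1) * 1 \<le> real (a + 1) * log 2 (real n)" using L by (intro mult_left_mono) auto
      moreover have "real c * real l \<le> real c * (2 * log 2 (real n))" using L l' by (intro mult_left_mono) auto
      moreover have "real \<kappa> = real (a + 1) * 1 + real c * real l" unfolding \<kappa> by simp
      ultimately show ?thesis by linarith
    qed
    also have "\<dots> = A * log 2 (real n)" unfolding A_def by (simp add: algebra_simps)
    finally have "real \<kappa> / real v \<le> A * log 2 (real n) / real v" by (intro divide_right_mono) auto
    then have "2 ^ t \<le> (2 * A) * (log 2 (real n) / real v)" using t' by simp
    then have "real t \<le> log 2 ((2 * A) * (log 2 (real n) / real v))"
      unfolding log_t using A L v by (subst log_le_cancel_iff) auto
    also have "\<dots> = log 2 (2 * A) + log 2 (log 2 (real n) / real v)"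
      using A L v by (subst log_mult) auto
    also have "log 2 (2 * A) = 1 + log 2 A" using A by (simp add: log_mult)
    finally show ?thesis by simp
  qed
qed

lemma exists_injective_code:
  fixes U :: "'k set"
  assumes "finite U" "card U \<le> 2 ^ \<kappa>"
  shows "\<exists>f :: 'k \<Rightarrow> bits. inj_on f U \<and> (\<forall>k\<in>U. length (f k) = \<kappa>)"
proof -
  obtain f :: "'k \<Rightarrow> bits" where "inj_on f U" "f ` U \<subseteq> {u. length u = \<kappa>}"
    using card_le_inj[of U "{u :: bits. length u = \<kappa>}"] assms
    by (auto simp: finite_bits_length card_bits_length)
  then show ?thesis by blast
qed


text \<open>The bound on the expected size for \<open>D i = l + t + (n - i) * w div N\<close>: the
  fixed part \<open>t\<close> costs three bits per key and level, while the part that depends on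
  \<open>i\<close> is paid by values not yet stored and makes the exceptions cheap.\<close>

lemma size_bound:
  fixes a c n v l t \<kappa> w i :: nat
  defines "A \<equiv> real (a + 2 * c + 1)"
  defines "Z \<equiv> max (log 2 (log 2 (real n) / real v)) 0"
  defines "N \<equiv> 3 * n"
  assumes n: "1 \<le> n" and v: "1 \<le> v" and l: "n \<le> 2 ^ l" "2 ^ l \<le> 2 * n"
    and \<kappa>: "\<kappa> = a + c * l + 1" and w: "w = min v \<kappa>" and t: "\<kappa> \<le> w * 2 ^ t" "w * 2 ^ t \<le> 2 * \<kappa>"
    and i: "i \<le> n"
  shows "real ((l + t + w) * \<kappa>) + 3 * real (2 ^ l + i * (l + t + (n - i) * w div N - l)) + 6 * real n + 2 +
      real (i * (1 + v)) + real \<kappa> * (\<Sum>j<i. real n / 2 ^ (l + t + (n - Suc j) * w div N)) \<le>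
    real n * real v + (32 * A\<^sup>2 + 4 * A + 3 * log 2 A + 30) * real n + 3 * (real n * Z)"
proof -
  have w1: "1 \<le> w" and w\<kappa>: "w \<le> \<kappa>" and wv: "w \<le> v" using v \<kappa> w by auto
  have A1: "1 \<le> A" unfolding A_def by simp
  have \<kappa>A: "\<kappa> \<le> (a + 2 * c + 1) * (l + 1)" unfolding \<kappa> by (simp add: algebra_simps)
  have l1: "l + 1 \<le> 2 * n" using less_exp[of l] l(2) by linarith
  have "t < 2 ^ t" by (rule less_exp)
  also have "2 ^ t \<le> w * 2 ^ t" using w1 by simp
  finally have "t \<le> 2 * \<kappa>" using t(2) by linarith
  moreover have "l + 1 \<le> (a + 2 * c + 1) * (l + 1)" by simp
  ultimately have "l + t + w \<le> 4 * ((a + 2 * c + 1) * (l + 1))" using w\<kappa> \<kappa>A by linarith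
  then have "(l + t + w) * \<kappa> \<le> 4 * ((a + 2 * c + 1) * (l + 1)) * ((a + 2 * c + 1) * (l + 1))"
    using \<kappa>A by (intro mult_le_mono)
  also have "\<dots> = 4 * (a + 2 * c + 1)\<^sup>2 * (l + 1)\<^sup>2" by (simp only: power2_eq_square mult_ac)
  also have "\<dots> \<le> 4 * (a + 2 * c + 1)\<^sup>2 * (4 * (2 * n))"
    using Suc_square_le_power_two[of l] l(2) by (intro mult_le_mono2) linarith
  finally have "real ((l + t + w) * \<kappa>) \<le> real (4 * (a + 2 * c + 1)\<^sup>2 * (4 * (2 * n)))"
    by (simp only: of_nat_le_iff)
  then have seed: "real ((l + t + w) * \<kappa>) \<le> 32 * A\<^sup>2 * real n" unfolding A_def by simp

  \<comment> \<open>The 3 in \<open>N\<close> cancels the three bits per key and level, so that the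
    variable part of the depth fits into \<open>(n - i) * v\<close> bits.\<close>
  have "3 * (i * ((n - i) * w div N)) \<le> N * ((n - i) * w div N)" using i unfolding N_def by simp
  also have "\<dots> \<le> (n - i) * w" by (rule times_div_less_eq_dividend)
  also have "\<dots> \<le> (n - i) * v" using wv by (rule mult_le_mono2)
  finally have "3 * (i * ((n - i) * w div N)) + i * v \<le> (n - i) * v + i * v" by (rule add_right_mono)
  also have "\<dots> = n * v" using i by (simp add: add_mult_distrib[symmetric])
  finally have "3 * (i * (t + (n - i) * w div N)) + i * v \<le> n * v + 3 * (n * t)"
    using mult_le_mono1[OF i, of t] unfolding add_mult_distrib2 by linarith
  then have "3 * (2 ^ l + i * (l + t + (n - i) * w div N - l)) + 2 + i * (1 + v) \<le> n * v + 3 * (n * t) + 9 * n"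
    using l(2) i n by simp
  then have "real (3 * (2 ^ l + i * (l + t + (n - i) * w div N - l)) + 2 + i * (1 + v)) \<le>
      real (n * v + 3 * (n * t) + 9 * n)"
    by (simp only: of_nat_le_iff)
  then have trie: "3 * real (2 ^ l + i * (l + t + (n - i) * w div N - l)) + 2 + real (i * (1 + v)) \<le>
      real n * real v + 3 * (real n * real t) + 9 * real n"
    by (simp only: of_nat_add of_nat_mult of_nat_numeral)

  have "real t \<le> 1 + log 2 A + Z"
    unfolding A_def Z_def by (rule key_length_ratio[OF n v l(2) \<kappa> w t(2)])
  then have "real n * real t \<le> real n * (1 + log 2 A + Z)" by (intro mult_left_mono) auto
  then have nt: "3 * (real n * real t) \<le> 3 * real n + 3 * log 2 A * real n + 3 * (real n * Z)"
    by (simp add: algebra_simps)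

  \<comment> \<open>\<open>2 ^ l\<close> absorbs \<open>n\<close>, and \<open>2 ^ t\<close> reduces
    the key length \<open>\<kappa>\<close> to \<open>w\<close>.\<close>
  have "real \<kappa> * (real n / 2 ^ (l + t + q)) \<le> real w * (1 / 2 ^ q)" for q
  proof -
    have "\<kappa> * n \<le> w * 2 ^ t * 2 ^ l" using t(1) l(1) by (rule mult_le_mono)
    then have "real (\<kappa> * n) \<le> real (w * 2 ^ t * 2 ^ l)" by (simp only: of_nat_le_iff)
    then show ?thesis by (simp add: power_add field_simps)
  qed
  then have "real \<kappa> * (\<Sum>j<i. real n / 2 ^ (l + t + (n - Suc j) * w div N)) \<le>
      (\<Sum>j<i. real w * (1 / 2 ^ ((n - Suc j) * w div N)))"
    unfolding sum_distrib_left by (intro sum_mono)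
  also have "\<dots> \<le> (\<Sum>j<n. real w * (1 / 2 ^ ((n - Suc j) * w div N)))"
    using i by (intro sum_mono2) auto
  also have "\<dots> = real w * (\<Sum>r<n. 1 / 2 ^ (r * w div N))"
    unfolding sum_distrib_left by (rule sum.nat_diff_reindex)
  also have "\<dots> \<le> 2 * real w + 4 * real N"
    using n by (intro weighted_power_sum_le w1) (simp add: N_def)
  also have "real w \<le> A * (2 * real n)"
  proof -
    have "w \<le> (a + 2 * c + 1) * (2 * n)" using w\<kappa> \<kappa>A mult_le_mono2[OF l1, of "a + 2 * c + 1"] by linarith
    then have "real w \<le> real ((a + 2 * c + 1) * (2 * n))" by (simp only: of_nat_le_iff)
    then show ?thesis unfolding A_def by (simp only: of_nat_mult of_nat_numeral)
  qed
  finally have exc: "real \<kappa> * (\<Sum>j<i. real n / 2 ^ (l + t + (n - Suc j) * w div N)) \<le>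
      4 * A * real n + 12 * real n"
    unfolding N_def by simp
  \<comment> \<open>The 30 is 9 from \<open>trie\<close>, 3 from \<open>nt\<close>, 12 from
    \<open>exc\<close> and the 6 for collisions.\<close>
  from seed trie nt exc show ?thesis unfolding distrib_right by linarith
qed

theorem theorem1:
  fixes a c :: nat
  shows "\<exists>C\<^sub>1 C\<^sub>2 :: real. C\<^sub>1 \<ge> 0 \<and> C\<^sub>2 \<ge> 0 \<and>
    (\<forall>(n::nat) (v::nat) (U::'k set).
       n \<ge> 1 \<and> v \<ge> 1 \<and> finite U \<and> card U \<le> a * n ^ c \<longrightarrow>
       (\<exists>D. incremental_retrieval n v U D \<and>
            expected_size_at_most n v U D
              (real n * real v + C\<^sub>1 * real n
                + C\<^sub>2 * max (real n * log 2 (log 2 (real n) / real v)) 0)))"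
proof -
  define A where "A = real (a + 2 * c + 1)"
  define C where "C = 32 * A\<^sup>2 + 4 * A + 3 * log 2 A + 30"
  have "0 \<le> C" unfolding C_def A_def by simp
  moreover have "\<exists>DS. incremental_retrieval n v U DS \<and> expected_size_at_most n v U DS
      (real n * real v + C * real n + 3 * max (real n * log 2 (log 2 (real n) / real v)) 0)"
    if n: "1 \<le> n" and v: "1 \<le> v" and U: "finite U" "card U \<le> a * n ^ c" for n v and U :: "'k set"
  proof -
    obtain l where l: "n \<le> 2 ^ l" "2 ^ l \<le> 2 * n" using ex_scaled_power_two[of 1 n] n by auto
    define \<kappa> where "\<kappa> = a + c * l + 1"
    \<comment> \<open>The cap at \<open>\<kappa>\<close> keeps the number \<open>l + t + w\<close>
      of hash bits, and hence the seed, small however large \<open>v\<close> is.\<close>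
    define w where "w = min v \<kappa>"
    have "1 \<le> w" "w \<le> \<kappa>" using v by (auto simp: w_def \<kappa>_def)
    then obtain t where t: "\<kappa> \<le> w * 2 ^ t" "w * 2 ^ t \<le> 2 * \<kappa>" using ex_scaled_power_two by blast
    define D where "D i = l + t + (n - i) * w div (3 * n)" for i
    \<comment> \<open>A universe of polynomial size has key codes of \<open>\<kappa>\<close> = O(log
      n) bits.\<close>
    have "a * n ^ c \<le> 2 ^ a * (2 ^ l) ^ c" using l(1) by (intro mult_le_mono power_mono) auto
    also have "\<dots> = 2 ^ (a + c * l)" by (simp add: power_add power_mult[symmetric] mult.commute)
    also have "\<dots> \<le> 2 ^ \<kappa>" unfolding \<kappa>_def by simp
    finally obtain f :: "'k \<Rightarrow> bits" where f: "inj_on f U" "\<forall>k\<in>U. length (f k) = \<kappa>"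
      using exists_injective_code[of U \<kappa>] U by auto
    interpret hashed_trie n v U f \<kappa> "l + t + w" l D
    proof
      fix i
      have "(n - i) * w div (3 * n) \<le> (3 * n) * w div (3 * n)" by (intro div_le_mono mult_le_mono1) simp
      then show "D i \<le> l + t + w" unfolding D_def using n by simp
      show "D (Suc i) \<le> D i" unfolding D_def by (intro add_left_mono div_le_mono mult_le_mono1) simp
    qed (use f l in \<open>auto simp: D_def\<close>)
    have "expected_size_at_most n v U DS
      (real n * real v + C * real n + 3 * max (real n * log 2 (log 2 (real n) / real v)) 0)"
      unfolding expected_size_at_most_def
    proof (intro allI impI)
      fix as assume legal: "legal n v U as"
      define i where "i = card (dom (contents as))"
      have i: "i \<le> n" using legal_contents[OF legal] unfolding i_def by simp
      have Z: "real n * max (log 2 (log 2 (real n) / real v)) 0 =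
          max (real n * log 2 (log 2 (real n) / real v)) 0"
        by (simp add: max_mult_distrib_left)
      note expected_size_DS_le[OF legal, folded i_def]
      also note ennreal_leI[OF size_bound[OF n v l \<kappa>_def w_def t i, folded D_def A_def, folded C_def,
            unfolded Z]]
      finally show "expected_size DS as \<le> ennreal
          (real n * real v + C * real n + 3 * max (real n * log 2 (log 2 (real n) / real v)) 0)" .
    qed
    with incremental_retrieval_DS show ?thesis by blast
  qed
  ultimately show ?thesis by (intro exI[of _ C] exI[of _ 3]) auto
qed

end
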